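(* Let $\alpha>0$, $k^t\in\mathbb{N}$, $k^d\in\mathbb{N}$. For every deterministic online policy $\mathrm{ALG}$ for the relief distribution problem with $k^t$ trucks, $k^d$ drones and drone speed $\alpha$, the best-case drone-impact ratio satisfies $$\underline{\omega}(\mathrm{ALG})\ \ge\ \frac{1}{1+\alpha\left\lceil \frac{k^d}{k^t}\right\rceil}.$$
   Context: Relief distribution problem (RDP). $\mathbb{N}=\{1,2,\dots\}$. An instance is $I=(k^t,k^d,\alpha,G,D)$: $k^t,k^d\in\mathbb{N}$ are the numbers of trucks and drones; $\alpha>0$ is the drone speed; $G=(V,E,c)$ is a finite connected undirected graph (not necessarily complete) with $V=\{v_0\}\cup C$, where $v_0$ is the depot and $C\neq\emptyset$ is the set of non-depot nodes; edge lengths $c(i,j)>0$ satisfy the triangle inequality; $D\subseteq C$ is the set of damaged nodes. For non-adjacent $i,j$, $c(i,j)$ is the shortest-path distance. A truck needs time $c(i,j)$ to traverse an edge, a drone needs $\frac1\alpha c(i,j)$. A tour is a closed walk in $G$ starting and ending at $v_0$ (possibly of length $0$); it visits all nodes lying on it. The makespan of a family of tours is the maximum duration of a tour. A feasible solution consists of $k^t$ truck tours and $k^d$ drone tours such that every node of $C$ is visited by some vehicle and every node of $D$ is visited by a truck. For integers $m,n\ge 0$ with $m+n\ge1$ and $W\subseteq C$, $\mathrm{TSP}_{m,n}(W)$ denotes the minimum makespan over all families of $m$ truck tours and $n$ drone tours that together visit all nodes of $W$. Online setting: initially everything except $D$ is known; whether $v\in C$ is damaged is revealed (to all vehicles, instantly)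 when some vehicle first arrives at $v$. A deterministic online policy $\mathrm{ALG}$ prescribes at every time, based only on the initially known data and the damage statuses revealed so far, how each vehicle acts (move along edges or wait), all vehicles starting at $v_0$ at time $0$, such that for every $D$ the executed tours form a feasible solution. $\mathrm{ALG}(I)$ is the time at which the last vehicle has returned to $v_0$. Best-case drone-impact ratio: $\underline{\omega}(\mathrm{ALG})=\inf_I \frac{\mathrm{ALG}(I)}{\mathrm{TSP}_{k^t,0}(C)}$, the infimum being over all instances $I$ with the given $k^t,k^d,\alpha$ (and $C=C(I)$ the non-depot nodes of $I$). *)

theory Defs
  imports "HOL-Analysis.Analysis" "Graph_Theory.Graph_Theory"
begin

section \<open>Networks and tours\<close>

record 'v network =
  graph :: "'v pair_pre_digraph"
  depot :: 'v
  cost :: "'v \<times> 'v \<Rightarrow> real"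

definition customers :: "'v network \<Rightarrow> 'v set" where
  "customers N = pverts (graph N) - {depot N}"

text \<open>\<^locale>\<open>pair_graph\<close> is the locale of finite simple graphs, an undirected edge being a pair of
  opposite arcs. The function \<^const>\<open>cost\<close> gives the length of an edge on adjacent nodes; on all other
  pairs of nodes it is the shortest-path distance \<^const>\<open>wf_digraph.\<mu>\<close>, which looks at arcs only.\<close>

definition valid_network :: "'v network \<Rightarrow> bool" where
  "valid_network N \<longleftrightarrow>
     pair_graph (graph N) \<and>
     Digraph_Component.connected (with_proj (graph N)) \<and>
     depot N \<in> pverts (graph N) \<and>
     customers N \<noteq> {} \<and>
     (\<forall>e \<in> parcs (graph N). cost N e > 0) \<and>
     (\<forall>u \<in> pverts (graph N). \<forall>v \<in> pverts (graph N). cost N (u, v) = cost N (v, u)) \<and>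
     (\<forall>u \<in> pverts (graph N). \<forall>v \<in> pverts (graph N). (u, v) \<notin> parcs (graph N) \<longrightarrow>
        ereal (cost N (u, v)) = wf_digraph.\<mu> (with_proj (graph N)) (cost N) u v) \<and>
     (\<forall>u \<in> pverts (graph N). \<forall>v \<in> pverts (graph N). \<forall>w \<in> pverts (graph N).
        cost N (u, w) \<le> cost N (u, v) + cost N (v, w))"

datatype vehicle = Truck nat | Drone nat

definition fleet :: "nat \<Rightarrow> nat \<Rightarrow> vehicle set" where
  "fleet m n = Truck ` {..<m} \<union> Drone ` {..<n}"

fun speed :: "real \<Rightarrow> vehicle \<Rightarrow> real" where
  "speed \<alpha> (Truck i) = 1"
| "speed \<alpha> (Drone i) = \<alpha>"

definition tour :: "'v network \<Rightarrow> 'v list \<Rightarrow> bool" where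
  "tour N p \<longleftrightarrow> vwalk p (with_proj (graph N)) \<and> hd p = depot N \<and> last p = depot N"

definition duration :: "real \<Rightarrow> 'v network \<Rightarrow> vehicle \<Rightarrow> 'v list \<Rightarrow> real" where
  "duration \<alpha> N j p = (\<Sum>e\<leftarrow>vwalk_arcs p. cost N e / speed \<alpha> j)"

definition makespan ::
    "real \<Rightarrow> 'v network \<Rightarrow> nat \<Rightarrow> nat \<Rightarrow> (vehicle \<Rightarrow> 'v list) \<Rightarrow> real" where
  "makespan \<alpha> N m n p = Max ((\<lambda>j. duration \<alpha> N j (p j)) ` fleet m n)"

text \<open>The infimum is a minimum: only finitely many tours have a duration below any given bound.\<close>

definition TSP :: "real \<Rightarrow> 'v network \<Rightarrow> nat \<Rightarrow> nat \<Rightarrow> 'v set \<Rightarrow> real" where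
  "TSP \<alpha> N m n W =
     Inf {makespan \<alpha> N m n p | p.
       (\<forall>j \<in> fleet m n. tour N (p j)) \<and> W \<subseteq> (\<Union>j \<in> fleet m n. set (p j))}"

definition feasible_solution ::
    "nat \<Rightarrow> nat \<Rightarrow> 'v network \<Rightarrow> 'v set \<Rightarrow> (vehicle \<Rightarrow> 'v list) \<Rightarrow> bool" where
  "feasible_solution kt kd N D p \<longleftrightarrow>
     (\<forall>j \<in> fleet kt kd. tour N (p j)) \<and>
     (\<forall>v \<in> customers N. \<exists>j \<in> fleet kt kd. v \<in> set (p j)) \<and>
     (\<forall>v \<in> D. \<exists>i < kt. v \<in> set (p (Truck i)))"


section \<open>Trajectories\<close>

text \<open>Positions are points of the geometric realisation of the graph, in barycentric coordinates:
  \<^term>\<open>on_arc u w l\<close> is the point that divides the edge from \<^term>\<open>u\<close> to \<^term>\<open>w\<close> in the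
  ratio \<^term>\<open>l\<close> to \<^term>\<open>1 - l\<close>.\<close>

definition node :: "'v \<Rightarrow> 'v \<Rightarrow> real" where
  "node v = (\<lambda>z. of_bool (z = v))"

definition on_arc :: "'v \<Rightarrow> 'v \<Rightarrow> real \<Rightarrow> 'v \<Rightarrow> real" where
  "on_arc u w l = (\<lambda>z. (1 - l) * node u z + l * node w z)"

definition rests :: "(real \<Rightarrow> 'v \<Rightarrow> real) \<Rightarrow> real \<Rightarrow> bool" where
  "rests x t \<longleftrightarrow> (\<exists>\<epsilon>>0. \<forall>h\<in>{0..<\<epsilon>}. x (t + h) = x t)"

definition heads_for :: "'v network \<Rightarrow> real \<Rightarrow> (real \<Rightarrow> 'v \<Rightarrow> real) \<Rightarrow> real \<Rightarrow> 'v \<Rightarrow> bool" where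
  "heads_for N s x t w \<longleftrightarrow>
     (\<exists>u l. (u, w) \<in> parcs (graph N) \<and> 0 \<le> l \<and> l < 1 \<and>
       (\<exists>\<epsilon>>0. \<forall>h\<in>{0..<\<epsilon>}. x (t + h) = on_arc u w (l + s * h / cost N (u, w))))"

text \<open>\<^term>\<open>p\<close> is the sequence of nodes met along \<^term>\<open>x\<close>, and \<open>\<tau> i\<close> a time of arrival at the
  \<open>i\<close>-th of them. Between two consecutive times the trajectory may pause, or leave a node and turn
  back before it meets another node.\<close>

definition traces :: "(real \<Rightarrow> 'v \<Rightarrow> real) \<Rightarrow> 'v list \<Rightarrow> bool" where
  "traces x p \<longleftrightarrow> p \<noteq> [] \<and>
     (\<exists>\<tau> :: nat \<Rightarrow> real. \<tau> 0 = 0 \<and>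
       (\<forall>i. Suc i < length p \<longrightarrow> \<tau> i \<le> \<tau> (Suc i)) \<and>
       (\<forall>i < length p. x (\<tau> i) = node (p ! i) \<and>
         (\<forall>t v. \<tau> i \<le> t \<and> (Suc i < length p \<longrightarrow> t < \<tau> (Suc i)) \<and> x t = node v \<longrightarrow> v = p ! i)))"


section \<open>Online policies\<close>

text \<open>The statuses revealed up to and including time \<^term>\<open>t\<close>.\<close>

definition revealed ::
    "nat \<Rightarrow> nat \<Rightarrow> 'v network \<Rightarrow> 'v set \<Rightarrow> (vehicle \<Rightarrow> real \<Rightarrow> 'v \<Rightarrow> real) \<Rightarrow> real \<Rightarrow> 'v \<rightharpoonup> bool" where
  "revealed kt kd N D X t =
     (\<lambda>v. if v \<in> customers N \<and> (\<exists>j \<in> fleet kt kd. \<exists>s \<in> {0..t}. X j s = node v)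
          then Some (v \<in> D) else None)"

text \<open>The arguments are the network, the current time and the statuses revealed so far; the result
  tells each vehicle to wait (\<^const>\<open>None\<close>) or to move towards a node (\<^const>\<open>Some\<close>). The times of the
  revelations and the positions need not be passed: the policy being deterministic, they can be
  recomputed from these arguments. The numbers of vehicles and the drone speed are fixed.\<close>

type_synonym 'v policy = "'v network \<Rightarrow> real \<Rightarrow> ('v \<rightharpoonup> bool) \<Rightarrow> vehicle \<Rightarrow> 'v option"

definition execution ::
    "nat \<Rightarrow> nat \<Rightarrow> real \<Rightarrow> 'v policy \<Rightarrow> 'v network \<Rightarrow> 'v set \<Rightarrow>
      (vehicle \<Rightarrow> real \<Rightarrow> 'v \<Rightarrow> real) \<Rightarrow> bool" where
  "execution kt kd \<alpha> ALG N D X \<longleftrightarrow>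
     (\<forall>j \<in> fleet kt kd.
        X j 0 = node (depot N) \<and>
        (\<forall>v. continuous_on {0..} (\<lambda>t. X j t v)) \<and>
        (\<forall>t \<ge> 0. case ALG N t (revealed kt kd N D X t) j of
             None \<Rightarrow> rests (X j) t
           | Some w \<Rightarrow> heads_for N (speed \<alpha> j) (X j) t w))"

lemma on_arc_inject:
  assumes "u \<noteq> w" "u' \<noteq> w" "0 \<le> l" "l < 1" "0 \<le> l'" "l' < 1"
    and eq: "on_arc u w l = on_arc u' w l'"
  shows "u = u'" "l = l'"
proof -
  have "on_arc u w l w = on_arc u' w l' w" "on_arc u w l u = on_arc u' w l' u"
    using eq by auto
  then show "l = l'" "u = u'"
    using assms by (auto simp: on_arc_def node_def split: if_splits)
qed

text \<open>A policy determines its execution.\<close>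

lemma execution_unique:
  assumes N: "valid_network N"
    and X: "execution kt kd \<alpha> ALG N D X" and Y: "execution kt kd \<alpha> ALG N D Y"
    and j: "j \<in> fleet kt kd" and t: "t \<ge> 0"
  shows "X j t = Y j t"
proof (rule ccontr)
  define S where "S = {t. t \<ge> 0 \<and> (\<exists>j \<in> fleet kt kd. X j t \<noteq> Y j t)}"
  assume "X j t \<noteq> Y j t"
  with j t have ne: "S \<noteq> {}" by (auto simp: S_def)
  have bdd: "bdd_below S" by (rule bdd_belowI[of _ 0]) (auto simp: S_def)
  define T where "T = Inf S"
  have T0: "T \<ge> 0" unfolding T_def using ne by (intro cInf_greatest) (auto simp: S_def)
  have before: "X i s = Y i s" if "i \<in> fleet kt kd" "0 \<le> s" "s < T" for i s
    using that cInf_lower[OF _ bdd, of s] by (force simp: S_def T_def)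
  have at: "X i T = Y i T" if i: "i \<in> fleet kt kd" for i
  proof (cases "T = 0")
    case True
    then show ?thesis using X Y i by (simp add: execution_def)
  next
    case False
    with T0 have cl: "closure {0..<T} = {0..T}" by (intro closure_atLeastLessThan) auto
    have "X i T v - Y i T v = 0" for v
    proof (rule continuous_constant_on_closure[where S = "{0..<T}"
          and f = "\<lambda>s. X i s v - Y i s v"])
      have "continuous_on {0..} (\<lambda>s. X i s v)" "continuous_on {0..} (\<lambda>s. Y i s v)"
        using X Y i by (auto simp: execution_def)
      then show "continuous_on (closure {0..<T}) (\<lambda>s. X i s v - Y i s v)"
        unfolding cl by (intro continuous_on_diff) (auto elim: continuous_on_subset)
    qed (use before i T0 cl in auto)
    then show ?thesis by auto
  qed
  have upto: "X i s = Y i s" if "i \<in> fleet kt kd" "0 \<le> s" "s \<le> T" for i s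
    using that before at by (cases "s = T") auto
  have rev: "revealed kt kd N D X T = revealed kt kd N D Y T"
    using upto by (fastforce simp: revealed_def fun_eq_iff)
  have "\<exists>\<epsilon>>0. \<forall>h\<in>{0..<\<epsilon>}. X i (T + h) = Y i (T + h)" if i: "i \<in> fleet kt kd" for i
  proof (cases "ALG N T (revealed kt kd N D X T) i")
    case None
    then have "rests (X i) T" "rests (Y i) T"
      using X Y i T0 rev by (force simp: execution_def)+
    then obtain a b where "a > 0" "b > 0" "\<forall>h\<in>{0..<a}. X i (T + h) = X i T"
      "\<forall>h\<in>{0..<b}. Y i (T + h) = Y i T"
      unfolding rests_def by blast
    then show ?thesis using at[OF i] by (intro exI[of _ "min a b"]) auto
  next
    case (Some w)
    then have "heads_for N (speed \<alpha> i) (X i) T w" "heads_for N (speed \<alpha> i) (Y i) T w"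
      using X Y i T0 rev by (force simp: execution_def)+
    then obtain u l a u' l' b
      where x: "(u, w) \<in> parcs (graph N)" "0 \<le> l" "l < 1" "a > 0"
        "\<And>h. h\<in>{0..<a} \<Longrightarrow> X i (T + h) = on_arc u w (l + speed \<alpha> i * h / cost N (u, w))"
      and y: "(u', w) \<in> parcs (graph N)" "0 \<le> l'" "l' < 1" "b > 0"
        "\<And>h. h\<in>{0..<b} \<Longrightarrow> Y i (T + h) = on_arc u' w (l' + speed \<alpha> i * h / cost N (u', w))"
      unfolding heads_for_def by blast
    interpret pair_graph "graph N" using N by (simp add: valid_network_def)
    have "u \<noteq> w" "u' \<noteq> w" using x(1) y(1) pair_no_loops by fastforce+
    moreover have "on_arc u w l = on_arc u' w l'"
      using x(5)[of 0] y(5)[of 0] x(4) y(4) at[OF i] by simp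
    ultimately have "u = u'" "l = l'" using x y on_arc_inject by metis+
    then show ?thesis using x y by (intro exI[of _ "min a b"]) auto
  qed
  then obtain e where e: "\<And>i. i \<in> fleet kt kd \<Longrightarrow> e i > 0 \<and> (\<forall>h\<in>{0..<e i}. X i (T + h) = Y i (T + h))"
    by metis
  define d where "d = Min (e ` fleet kt kd)"
  have fin: "finite (fleet kt kd)" by (simp add: fleet_def)
  have "d \<in> e ` fleet kt kd" unfolding d_def using fin j by (intro Min_in) auto
  then have d0: "d > 0" using e by auto
  have "T + d \<le> Inf S"
  proof (rule cInf_greatest[OF ne])
    fix s assume s: "s \<in> S"
    then obtain i where i: "i \<in> fleet kt kd" "X i s \<noteq> Y i s" by (auto simp: S_def)
    have "s \<ge> T" using cInf_lower[OF s bdd] by (simp add: T_def)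
    moreover have "d \<le> e i" using fin i by (auto simp: d_def)
    moreover have "\<not> s - T < e i" 
      using i \<open>s \<ge> T\<close> e[OF i(1), THEN conjunct2, THEN bspec, of "s - T"] by auto
    ultimately show "T + d \<le> s" by linarith
  qed
  with d0 show False by (simp add: T_def)
qed

definition returned_by ::
    "nat \<Rightarrow> nat \<Rightarrow> 'v network \<Rightarrow> (vehicle \<Rightarrow> real \<Rightarrow> 'v \<Rightarrow> real) \<Rightarrow> real \<Rightarrow> bool" where
  "returned_by kt kd N X T \<longleftrightarrow> T \<ge> 0 \<and> (\<forall>j \<in> fleet kt kd. \<forall>t \<ge> T. X j t = node (depot N))"

definition online_policy :: "nat \<Rightarrow> nat \<Rightarrow> real \<Rightarrow> 'v policy \<Rightarrow> bool" where
  "online_policy kt kd \<alpha> ALG \<longleftrightarrow>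
     (\<forall>N D. valid_network N \<and> D \<subseteq> customers N \<longrightarrow>
        (\<exists>X. execution kt kd \<alpha> ALG N D X) \<and>
        (\<forall>X. execution kt kd \<alpha> ALG N D X \<longrightarrow>
           (\<exists>T. returned_by kt kd N X T) \<and>
           (\<exists>p. (\<forall>j \<in> fleet kt kd. traces (X j) (p j)) \<and> feasible_solution kt kd N D p)))"

text \<open>By the uniqueness of executions, the value does not depend on the choice of \<^term>\<open>X\<close>; the
  infimum is attained since trajectories are continuous.\<close>

definition completion_time ::
    "nat \<Rightarrow> nat \<Rightarrow> real \<Rightarrow> 'v policy \<Rightarrow> 'v network \<Rightarrow> 'v set \<Rightarrow> real" where
  "completion_time kt kd \<alpha> ALG N D =
     (let X = (SOME X. execution kt kd \<alpha> ALG N D X) in Inf {T. returned_by kt kd N X T})"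

text \<open>Extended reals are used for the infimum only: it is over an empty set if the node type has a
  single element.\<close>

definition best_case_ratio :: "nat \<Rightarrow> nat \<Rightarrow> real \<Rightarrow> 'v policy \<Rightarrow> ereal" where
  "best_case_ratio kt kd \<alpha> ALG =
     (INF (N, D) \<in> {(N, D). valid_network N \<and> D \<subseteq> customers N}.
        ereal (completion_time kt kd \<alpha> ALG N D / TSP \<alpha> N kt 0 (customers N)))"

end

theory Submission
  imports Defs
begin

text \<open>Executing the policy yields tours whose durations are at most the completion time \<open>T\<close>. Append
  to each truck tour at most \<open>\<lceil>kd / kt\<rceil>\<close> of the drone tours. A drone tour has length at most
  \<open>\<alpha> T\<close>, so a truck completes its extended tour within \<open>(1 + \<alpha> \<lceil>kd / kt\<rceil>) T\<close>.

  That a vehicle cannot get from \<open>u\<close> to \<open>v\<close> faster than its speed allows is seen by extending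
  \<open>w \<mapsto> cost N (u, w)\<close> linearly to the geometric realisation: by the triangle inequality the
  extension has slope at most 1 along every edge, so it grows along a trajectory at most at the
  speed of the vehicle, wherever the vehicle goes.\<close>

section \<open>Walks and tours\<close>

definition tour_length :: "'v network \<Rightarrow> 'v list \<Rightarrow> real" where
  "tour_length N p = (\<Sum>e\<leftarrow>vwalk_arcs p. cost N e)"

lemma duration_eq_tour_length: "duration \<alpha> N j p = tour_length N p / speed \<alpha> j"
proof -
  have "(\<Sum>e\<leftarrow>es. cost N e / r) = (\<Sum>e\<leftarrow>es. cost N e) / r" for es r
    by (induction es) (auto simp: add_divide_distrib)
  then show ?thesis by (simp add: duration_def tour_length_def)
qed

lemma vwalk_arcs_join:
  assumes "p \<noteq> []" "q \<noteq> []" "last p = hd q"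
  shows "vwalk_arcs (p @ tl q) = vwalk_arcs p @ vwalk_arcs q"
  using assms by (cases q; cases "tl q") (auto simp: vwalk_arcs_append)

text \<open>Closed walks through the depot can be glued there; \<open>tl q\<close> drops the
  duplicate of the depot at the seam.\<close>

lemma tour_join:
  assumes "tour N p" "tour N q"
  shows "tour N (p @ tl q)" "set (p @ tl q) = set p \<union> set q"
    "tour_length N (p @ tl q) = tour_length N p + tour_length N q"
proof -
  have ne: "p \<noteq> []" "q \<noteq> []" and e: "last p = hd q"
    using assms by (auto simp: tour_def vwalk_def)
  have "hd q \<in> set p" using ne e by (metis last_in_set)
  then show S: "set (p @ tl q) = set p \<union> set q" using ne by (cases q) auto
  show "tour_length N (p @ tl q) = tour_length N p + tour_length N q"
    using vwalk_arcs_join[OF ne e] by (simp add: tour_length_def)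
  have "last (p @ tl q) = depot N"
    using assms ne by (cases q; cases "tl q") (auto simp: tour_def)
  then show "tour N (p @ tl q)"
    using assms ne S vwalk_arcs_join[OF ne e] by (auto simp: tour_def vwalk_def)
qed

lemma tour_concat:
  assumes "tour N p" "\<forall>q \<in> set qs. tour N q"
  shows "\<exists>r. tour N r \<and> set r = set p \<union> (\<Union>q \<in> set qs. set q) \<and>
    tour_length N r = tour_length N p + (\<Sum>q\<leftarrow>qs. tour_length N q)"
  using assms
proof (induction qs arbitrary: p)
  case Nil
  then show ?case by auto
next
  case (Cons q qs)
  then obtain r where "tour N r" "set r = set (p @ tl q) \<union> (\<Union>q \<in> set qs. set q)"
    "tour_length N r = tour_length N (p @ tl q) + (\<Sum>q\<leftarrow>qs. tour_length N q)"
    using tour_join(1)[of N p q] by (metis list.set_intros)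
  then show ?case using tour_join[of N p q] Cons.prems by (intro exI[of _ r]) auto
qed

text \<open>The bounds on the single arcs telescope. The induction generalises
  \<open>\<tau>\<close>, since the tail of the walk goes with the sequence shifted by one.\<close>

lemma sum_vwalk_arcs_le:
  fixes \<tau> :: "nat \<Rightarrow> real"
  assumes "p \<noteq> []" "\<And>i. Suc i < length p \<Longrightarrow> f (p ! i, p ! Suc i) \<le> \<tau> (Suc i) - \<tau> i"
  shows "(\<Sum>e\<leftarrow>vwalk_arcs p. f e) \<le> \<tau> (length p - 1) - \<tau> 0"
  using assms
proof (induction p arbitrary: \<tau> rule: vwalk_arcs.induct)
  case (3 x y xs)
  have "(\<Sum>e\<leftarrow>vwalk_arcs (y # xs). f e) \<le> \<tau> (Suc (length (y # xs) - 1)) - \<tau> (Suc 0)"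
    using 3(3)[of "Suc _"] by (intro 3(1)[of "\<lambda>i. \<tau> (Suc i)"]) auto
  moreover have "f (x, y) \<le> \<tau> (Suc 0) - \<tau> 0" using 3(3)[of 0] by simp
  ultimately show ?case by simp
qed auto

lemma nth_vwalk_arcs:
  "Suc i < length p \<Longrightarrow> (p ! i, p ! Suc i) \<in> set (vwalk_arcs p)"
  by (induction p arbitrary: i rule: vwalk_arcs.induct) (auto simp: nth_Cons split: nat.splits)

lemma tour_arcs: "tour N p \<Longrightarrow> set (vwalk_arcs p) \<subseteq> parcs (graph N)"
  by (force simp: tour_def vwalk_def arcs_ends_def arc_to_ends_def)

lemma tour_arc:
  assumes "tour N p" "Suc i < length p"
  shows "(p ! i, p ! Suc i) \<in> parcs (graph N)"
  using tour_arcs[OF assms(1)] nth_vwalk_arcs[OF assms(2)] by blast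

section \<open>Consequences of validity and positivity of the truck-only optimum\<close>

lemma valid_networkD:
  assumes "valid_network N"
  shows "pair_graph (graph N)" "finite (pverts (graph N))" "finite (parcs (graph N))"
    and "e \<in> parcs (graph N) \<Longrightarrow> cost N e > 0"
    and "(u, v) \<in> parcs (graph N) \<Longrightarrow> u \<in> pverts (graph N) \<and> v \<in> pverts (graph N) \<and> u \<noteq> v"
proof -
  show G: "pair_graph (graph N)" using assms by (simp add: valid_network_def)
  interpret pair_graph "graph N" by (fact G)
  show "finite (pverts (graph N))" "finite (parcs (graph N))"
    by simp_all
  show "e \<in> parcs (graph N) \<Longrightarrow> cost N e > 0" using assms by (simp add: valid_network_def)
  show "(u, v) \<in> parcs (graph N) \<Longrightarrow> u \<in> pverts (graph N) \<and> v \<in> pverts (graph N) \<and> u \<noteq> v"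
    using pair_no_loops by (fastforce dest: in_arcsD1 in_arcsD2)
qed

text \<open>A node is not adjacent to itself, so this cost is a shortest-path distance, and the
  empty walk bounds it. The potential used below therefore starts at a value of at most 0.\<close>

lemma cost_self_le_0:
  assumes N: "valid_network N" and u: "u \<in> pverts (graph N)"
  shows "cost N (u, u) \<le> 0"
proof -
  interpret pair_graph "graph N" using valid_networkD(1)[OF N] .
  have "(u, u) \<notin> parcs (graph N)" using valid_networkD(5)[OF N] by blast
  then have "ereal (cost N (u, u)) = wf_digraph.\<mu> (with_proj (graph N)) (cost N) u u"
    using N u by (simp add: valid_network_def)
  also have "\<dots> \<le> ereal (awalk_cost (cost N) [])"
    by (rule min_cost_le_walk_cost) (simp add: awalk_Nil_iff u)
  finally show ?thesis by simp
qed

text \<open>Visiting a customer forces the tour to traverse an arc. That arc also makes the set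
  under \<open>Min\<close> nonempty, hence its minimum positive.\<close>

lemma Min_cost_le_tour_length:
  assumes N: "valid_network N" and p: "tour N p" and c: "c \<in> customers N" "c \<in> set p"
  shows "Min (cost N ` parcs (graph N)) \<le> tour_length N p \<and> Min (cost N ` parcs (graph N)) > 0"
proof -
  note arcs = tour_arcs[OF p]
  have "hd p \<noteq> c" "p \<noteq> []" using p c by (auto simp: tour_def customers_def)
  then obtain x y xs where pe: "p = x # y # xs"
    using c by (cases p; cases "tl p") auto
  have a: "(x, y) \<in> set (vwalk_arcs p)" by (simp add: pe)
  have fin: "finite (cost N ` parcs (graph N))" using valid_networkD(3)[OF N] by simp
  have "cost N (x, y) \<le> tour_length N p"
    unfolding tour_length_def using a arcs valid_networkD(4)[OF N]
    by (intro member_le_sum_list) (auto intro: less_imp_le)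
  moreover have "Min (cost N ` parcs (graph N)) \<le> cost N (x, y)" using fin a arcs by auto
  moreover have "Min (cost N ` parcs (graph N)) \<in> cost N ` parcs (graph N)"
    using fin a arcs by (intro Min_in) auto
  ultimately show ?thesis using valid_networkD(4)[OF N] by auto
qed

lemma finite_fleet: "finite (fleet m n)"
  by (simp add: fleet_def)

lemma duration_le_makespan: "j \<in> fleet m n \<Longrightarrow> duration \<alpha> N j (p j) \<le> makespan \<alpha> N m n p"
  unfolding makespan_def by (intro Max_ge) (auto simp: finite_fleet)

lemma TSP_trucks_lower:
  assumes N: "valid_network N" and W: "c \<in> W" "W \<subseteq> customers N"
    and p: "\<forall>j \<in> fleet m 0. tour N (p j)" "W \<subseteq> (\<Union>j \<in> fleet m 0. set (p j))"
  shows "Min (cost N ` parcs (graph N)) \<le> makespan \<alpha> N m 0 p \<and> Min (cost N ` parcs (graph N)) > 0"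
proof -
  obtain j where j: "j \<in> fleet m 0" "c \<in> set (p j)" using W p by blast
  moreover have "duration \<alpha> N j (p j) = tour_length N (p j)"
    using j by (auto simp: duration_eq_tour_length fleet_def)
  ultimately show ?thesis
    using Min_cost_le_tour_length[OF N, of "p j" c] duration_le_makespan[OF j(1), of \<alpha> N p] p W
    by fastforce
qed

text \<open>The lower bound is uniform over all families of tours: it makes the infimum meaningful
  and keeps it away from 0.\<close>

lemma
  assumes N: "valid_network N" and W: "W \<noteq> {}" "W \<subseteq> customers N"
    and p: "\<forall>j \<in> fleet m 0. tour N (p j)" "W \<subseteq> (\<Union>j \<in> fleet m 0. set (p j))"
  shows TSP_trucks_le: "TSP \<alpha> N m 0 W \<le> makespan \<alpha> N m 0 p"
    and TSP_trucks_pos: "TSP \<alpha> N m 0 W > 0"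
proof -
  let ?M = "{makespan \<alpha> N m 0 p | p.
       (\<forall>j \<in> fleet m 0. tour N (p j)) \<and> W \<subseteq> (\<Union>j \<in> fleet m 0. set (p j))}"
  obtain c where c: "c \<in> W" using W by blast
  note lower = TSP_trucks_lower[OF N c W(2)]
  have "bdd_below ?M" using lower by (intro bdd_belowI[of _ "Min (cost N ` parcs (graph N))"]) blast
  then show "TSP \<alpha> N m 0 W \<le> makespan \<alpha> N m 0 p"
    unfolding TSP_def using p by (intro cInf_lower) auto
  have "Min (cost N ` parcs (graph N)) \<le> TSP \<alpha> N m 0 W"
    unfolding TSP_def using p lower by (intro cInf_greatest) force+
  then show "TSP \<alpha> N m 0 W > 0" using lower[OF p, of \<alpha>] by linarith
qed


section \<open>Trajectories\<close>

text \<open>The times at which the bound relative to \<open>a\<close> holds form a nonempty compact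
  set. Its largest element is \<open>b\<close>, as the local bound would carry any smaller one
  further to the right.\<close>

lemma right_local_growth_bound:
  fixes f :: "real \<Rightarrow> real"
  assumes ab: "a \<le> b" and cont: "continuous_on {a..b} f"
    and loc: "\<And>t. a \<le> t \<Longrightarrow> t < b \<Longrightarrow> \<exists>\<epsilon>>0. \<forall>h\<in>{0..<\<epsilon>}. f (t + h) \<le> f t + s * h"
  shows "f b \<le> f a + s * (b - a)"
proof -
  define S where "S = {t \<in> {a..b}. f t - s * t \<le> f a - s * a}"
  have "closed S" unfolding S_def
    by (intro continuous_on_closed_Collect_le continuous_intros cont)
  moreover have "bounded S" by (rule bounded_subset[of "{a..b}"]) (auto simp: S_def)
  moreover have "a \<in> S" using ab by (simp add: S_def)
  ultimately obtain c where c: "c \<in> S" "\<forall>t\<in>S. t \<le> c"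
    using compact_attains_sup[of S] by (auto simp: compact_eq_bounded_closed)
  have "c = b"
  proof (rule ccontr)
    assume "c \<noteq> b"
    with c have "a \<le> c" "c < b" by (auto simp: S_def)
    then obtain \<epsilon> where e: "\<epsilon> > 0" "\<forall>h\<in>{0..<\<epsilon>}. f (c + h) \<le> f c + s * h" using loc by blast
    \<comment> \<open>Halving keeps \<open>h\<close> inside the half-open interval of the local
      bound; \<open>b - c\<close> keeps \<open>c + h\<close> inside \<open>{a..b}\<close>.\<close>
    define h where "h = min (\<epsilon> / 2) (b - c)"
    have h: "h > 0" "h < \<epsilon>" "c + h \<le> b" using e \<open>c < b\<close> by (auto simp: h_def)
    then have "f (c + h) \<le> f c + s * h" using e by auto
    then have "c + h \<in> S" using c h by (auto simp: S_def algebra_simps)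
    then show False using c h by auto
  qed
  then show ?thesis using c by (simp add: S_def algebra_simps)
qed

text \<open>As a finite weighted sum of coordinates, it inherits continuity from the coordinates of
  a trajectory.\<close>

definition potential :: "'v network \<Rightarrow> 'v \<Rightarrow> ('v \<Rightarrow> real) \<Rightarrow> real" where
  "potential N u x = (\<Sum>w\<in>pverts (graph N). x w * cost N (u, w))"

lemma potential_node:
  assumes "finite (pverts (graph N))" "v \<in> pverts (graph N)"
  shows "potential N u (node v) = cost N (u, v)"
proof -
  have "potential N u (node v) = (\<Sum>w\<in>pverts (graph N). if w = v then cost N (u, w) else 0)"
    unfolding potential_def by (intro sum.cong) (auto simp: node_def)
  then show ?thesis using assms by simp
qed

lemma potential_on_arc:
  "potential N u (on_arc a w l) = (1 - l) * potential N u (node a) + l * potential N u (node w)"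
  by (simp add: potential_def on_arc_def sum_distrib_left sum.distrib[symmetric] algebra_simps)

text \<open>The coordinate along the arc grows at rate \<open>s / ?c\<close>, and a full traversal
  changes the potential by \<open>?d\<close>, at most \<open>?c\<close>. Only an upper bound is
  claimed, so approaching \<open>u\<close> is covered too.\<close>

lemma potential_heads_for:
  assumes N: "valid_network N" and u: "u \<in> pverts (graph N)" and s: "s > 0"
    and hf: "heads_for N s x t w"
  shows "\<exists>\<epsilon>>0. \<forall>h\<in>{0..<\<epsilon>}. potential N u (x (t + h)) \<le> potential N u (x t) + s * h"
proof -
  obtain a l \<epsilon> where a: "(a, w) \<in> parcs (graph N)" "\<epsilon> > 0"
    and x: "\<And>h. h\<in>{0..<\<epsilon>} \<Longrightarrow> x (t + h) = on_arc a w (l + s * h / cost N (a, w))"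
    using hf unfolding heads_for_def by blast
  let ?c = "cost N (a, w)" and ?d = "cost N (u, w) - cost N (u, a)"
  have c: "?c > 0" using valid_networkD(4)[OF N a(1)] .
  have V: "a \<in> pverts (graph N)" "w \<in> pverts (graph N)" using valid_networkD(5)[OF N a(1)] by auto
  have d: "?d \<le> ?c"
  proof -
    have "cost N (u, w) \<le> cost N (u, a) + cost N (a, w)"
      using N u V unfolding valid_network_def by blast
    then show ?thesis by simp
  qed
  have pot: "potential N u (on_arc a w r) = cost N (u, a) + r * ?d" for r
    using potential_node[OF valid_networkD(2)[OF N]] V
    by (simp add: potential_on_arc algebra_simps)
  have "potential N u (x (t + h)) \<le> potential N u (x t) + s * h" if h: "h \<in> {0..<\<epsilon>}" for h
  proof -
    \<comment> \<open>The instance \<open>x[of 0]\<close> identifies \<open>x t\<close> as the point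
      of the arc at parameter \<open>l\<close>.\<close>
    have "potential N u (x (t + h)) = potential N u (x t) + s * h / ?c * ?d"
      using x[OF h] x[of 0] a(2) by (simp add: pot algebra_simps)
    moreover have "s * h / ?c * ?d \<le> s * h / ?c * ?c"
      using d c s h by (intro mult_left_mono) auto
    ultimately show ?thesis using c by simp
  qed
  then show ?thesis using a(2) by blast
qed

lemma speed_pos: "\<alpha> > 0 \<Longrightarrow> speed \<alpha> j > 0"
  by (cases j) auto

text \<open>The potential centred at \<open>u\<close> rises from at most 0 to
  \<open>cost N (u, v)\<close>, at most at the speed of the vehicle. Pauses, turns and detours
  between \<open>a\<close> and \<open>b\<close> need no case analysis.\<close>

lemma execution_travel_time:
  assumes N: "valid_network N" and X: "execution kt kd \<alpha> ALG N D X" and \<alpha>: "\<alpha> > 0"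
    and j: "j \<in> fleet kt kd" and ab: "0 \<le> a" "a \<le> b"
    and u: "X j a = node u" "u \<in> pverts (graph N)" and v: "X j b = node v" "v \<in> pverts (graph N)"
  shows "cost N (u, v) / speed \<alpha> j \<le> b - a"
proof -
  let ?F = "\<lambda>t. potential N u (X j t)"
  have s: "speed \<alpha> j > 0" using speed_pos[OF \<alpha>] .
  have "?F b \<le> ?F a + speed \<alpha> j * (b - a)"
  proof (rule right_local_growth_bound[OF ab(2)])
    have "continuous_on {0..} (\<lambda>t. X j t w)" for w
      using X j by (auto simp: execution_def)
    then have "continuous_on {a..b} (\<lambda>t. X j t w)" for w
      by (rule continuous_on_subset) (use ab in auto)
    then show "continuous_on {a..b} ?F"
      unfolding potential_def by (intro continuous_intros)
  next
    fix t assume t: "a \<le> t" "t < b"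
    then have "t \<ge> 0" using ab by simp
    then have act: "case ALG N t (revealed kt kd N D X t) j of
             None \<Rightarrow> rests (X j) t | Some w \<Rightarrow> heads_for N (speed \<alpha> j) (X j) t w"
      using X j by (simp add: execution_def)
    show "\<exists>\<epsilon>>0. \<forall>h\<in>{0..<\<epsilon>}. ?F (t + h) \<le> ?F t + speed \<alpha> j * h"
    proof (cases "ALG N t (revealed kt kd N D X t) j")
      case None
      then obtain \<epsilon> where "\<epsilon> > 0" "\<forall>h\<in>{0..<\<epsilon>}. X j (t + h) = X j t"
        using act by (auto simp: rests_def)
      then show ?thesis using s by (intro exI[of _ \<epsilon>]) auto
    next
      case (Some w)
      then show ?thesis using act potential_heads_for[OF N u(2) s] by simp
    qed
  qed
  moreover have "?F a \<le> 0" "?F b = cost N (u, v)"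
    using potential_node[OF valid_networkD(2)[OF N]] u v cost_self_le_0[OF N u(2)] by auto
  ultimately show ?thesis using s by (simp add: field_simps)
qed

text \<open>The travel times sum up to at most the last arrival time. That this time is at most
  \<open>T\<close> requires its own argument, via the last node before the final depot.\<close>

lemma traced_tour_duration_le:
  assumes N: "valid_network N" and X: "execution kt kd \<alpha> ALG N D X" and \<alpha>: "\<alpha> > 0"
    and j: "j \<in> fleet kt kd" and p: "tour N p" "traces (X j) p"
    and T: "returned_by kt kd N X T"
  shows "duration \<alpha> N j p \<le> T"
proof -
  obtain \<tau> :: "nat \<Rightarrow> real" where ne: "p \<noteq> []" and t0: "\<tau> 0 = 0"
    and mono: "\<And>i. Suc i < length p \<Longrightarrow> \<tau> i \<le> \<tau> (Suc i)"
    and at: "\<And>i. i < length p \<Longrightarrow> X j (\<tau> i) = node (p ! i)"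
    and only: "\<And>i t v. i < length p \<Longrightarrow> \<tau> i \<le> t \<Longrightarrow> Suc i < length p \<longrightarrow> t < \<tau> (Suc i) \<Longrightarrow>
      X j t = node v \<Longrightarrow> v = p ! i"
    using p(2) unfolding traces_def by metis
  have nonneg: "i < length p \<Longrightarrow> \<tau> i \<ge> 0" for i
    by (induction i) (use t0 mono in \<open>force intro: order_trans\<close>)+
  have step: "cost N (p ! i, p ! Suc i) / speed \<alpha> j \<le> \<tau> (Suc i) - \<tau> i" if i: "Suc i < length p" for i
    using tour_arc[OF p(1) i] valid_networkD(5)[OF N] i
    by (intro execution_travel_time[OF N X \<alpha> j] nonneg mono at) auto
  have "duration \<alpha> N j p \<le> \<tau> (length p - 1)"
    using sum_vwalk_arcs_le[OF ne, of "\<lambda>e. cost N e / speed \<alpha> j" \<tau>] step t0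
    by (simp add: duration_def)
  also have "\<tau> (length p - 1) \<le> T"
  proof (cases "length p = 1")
    case True
    then show ?thesis using t0 T by (simp add: returned_by_def)
  next
    case False
    with ne obtain i where i: "length p = Suc (Suc i)"
      by (metis One_nat_def length_0_conv not0_implies_Suc)
    have arc: "(p ! i, p ! Suc i) \<in> parcs (graph N)" using tour_arc[OF p(1), of i] i by simp
    have "p ! Suc i = depot N" using p(1) i ne by (simp add: tour_def last_conv_nth)
    then have nd: "p ! i \<noteq> depot N" using valid_networkD(5)[OF N arc] by simp
    have "0 < cost N (p ! i, p ! Suc i) / speed \<alpha> j"
      using valid_networkD(4)[OF N arc] speed_pos[OF \<alpha>] by simp
    \<comment> \<open>Strictness leaves room for a time that is at least \<open>T\<close> but before
      the final arrival.\<close>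
    then have less: "\<tau> i < \<tau> (Suc i)" using step[of i] i by linarith
    show ?thesis
    \<comment> \<open>At time \<open>max (\<tau> i) T\<close> the vehicle would be back at the
      depot, while \<open>p ! i\<close> is the only node it may meet before
      \<open>\<tau> (Suc i)\<close>.\<close>
    proof (rule ccontr)
      assume "\<not> \<tau> (length p - 1) \<le> T"
      then have "max (\<tau> i) T < \<tau> (Suc i)" using i less by simp
      moreover have "X j (max (\<tau> i) T) = node (depot N)"
        using T j by (simp add: returned_by_def)
      ultimately show False using only[of i "max (\<tau> i) T" "depot N"] nd i by simp
    qed
  qed
  finally show ?thesis .
qed


section \<open>Serving the drone tours by truck\<close>

lemma trucks_take_over_drone_tours:
  assumes N: "valid_network N" and \<alpha>: "\<alpha> > 0" and kt: "kt \<ge> 1" and K: "kd \<le> kt * K"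
    and T: "T \<ge> 0"
    and p: "\<forall>j \<in> fleet kt kd. tour N (p j) \<and> duration \<alpha> N j (p j) \<le> T"
    and cover: "customers N \<subseteq> (\<Union>j \<in> fleet kt kd. set (p j))"
  shows "TSP \<alpha> N kt 0 (customers N) \<le> (1 + \<alpha> * real K) * T" "TSP \<alpha> N kt 0 (customers N) > 0"
proof -
  \<comment> \<open>Truck \<open>i\<close> takes over a block of \<open>K\<close> consecutive
    drones. The minimum cuts the blocks off at \<open>kd\<close>, so late ones may be short or
    empty.\<close>
  define ds where "ds i = [i * K..<min (Suc i * K) kd]" for i
  have dr: "tour N (p (Drone d))" "tour_length N (p (Drone d)) \<le> \<alpha> * T" if "d < kd" for d
  proof -
    have "Drone d \<in> fleet kt kd" using that by (simp add: fleet_def)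
    then have "tour N (p (Drone d)) \<and> duration \<alpha> N (Drone d) (p (Drone d)) \<le> T" using p by blast
    then show "tour N (p (Drone d))" "tour_length N (p (Drone d)) \<le> \<alpha> * T"
      using \<alpha> by (auto simp: duration_eq_tour_length field_simps)
  qed
  have tr: "tour N (p (Truck i))" "tour_length N (p (Truck i)) \<le> T" if "i < kt" for i
  proof -
    have "Truck i \<in> fleet kt kd" using that by (simp add: fleet_def)
    then have "tour N (p (Truck i)) \<and> duration \<alpha> N (Truck i) (p (Truck i)) \<le> T" using p by blast
    then show "tour N (p (Truck i))" "tour_length N (p (Truck i)) \<le> T"
      by (auto simp: duration_eq_tour_length)
  qed
  have "\<exists>r. tour N r \<and> set r = set (p (Truck i)) \<union> (\<Union>d \<in> set (ds i). set (p (Drone d))) \<and>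
      tour_length N r \<le> (1 + \<alpha> * real K) * T" if i: "i < kt" for i
  proof -
    have "\<forall>q \<in> set (map (\<lambda>d. p (Drone d)) (ds i)). tour N q" using dr by (auto simp: ds_def)
    from tour_concat[OF tr(1)[OF i] this] obtain r where
      r: "tour N r" "set r = set (p (Truck i)) \<union> (\<Union>d \<in> set (ds i). set (p (Drone d)))"
        "tour_length N r = tour_length N (p (Truck i)) + (\<Sum>d\<leftarrow>ds i. tour_length N (p (Drone d)))"
      by (auto simp: o_def)
    have "(\<Sum>d\<leftarrow>ds i. tour_length N (p (Drone d))) \<le> (\<Sum>d\<leftarrow>ds i. \<alpha> * T)"
      using dr by (intro sum_list_mono) (auto simp: ds_def)
    also have "\<dots> = real (length (ds i)) * (\<alpha> * T)" by (simp add: sum_list_triv)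
    also have "\<dots> \<le> real K * (\<alpha> * T)"
      using \<alpha> T by (intro mult_right_mono) (auto simp: ds_def)
    finally show ?thesis using r tr(2)[OF i] by (intro exI[of _ r]) (auto simp: algebra_simps)
  qed
  then obtain r where r: "\<And>i. i < kt \<Longrightarrow> tour N (r i)"
    "\<And>i. i < kt \<Longrightarrow> set (r i) = set (p (Truck i)) \<union> (\<Union>d \<in> set (ds i). set (p (Drone d)))"
    "\<And>i. i < kt \<Longrightarrow> tour_length N (r i) \<le> (1 + \<alpha> * real K) * T"
    by metis
  \<comment> \<open>The value at drones is a dummy: \<open>fleet kt 0\<close> contains only
    trucks.\<close>
  define q where "q j = (case j of Truck i \<Rightarrow> r i | Drone i \<Rightarrow> [])" for j
  have q: "\<forall>j \<in> fleet kt 0. tour N (q j)" using r by (auto simp: fleet_def q_def)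
  have "\<exists>i<kt. d \<in> set (ds i)" if d: "d < kd" for d
  proof (intro exI conjI)
    have "K > 0" using d K by (cases K) auto
    have "d < kt * K" using d K by simp
    then show "d div K < kt" using \<open>K > 0\<close> by (simp add: div_less_iff_less_mult)
    show "d \<in> set (ds (d div K))"
      using d \<open>K > 0\<close> dividend_less_div_times[of K d] by (auto simp: ds_def)
  qed
  then have "(\<Union>j \<in> fleet kt kd. set (p j)) \<subseteq> (\<Union>j \<in> fleet kt 0. set (q j))"
    using r(2) by (fastforce simp: fleet_def q_def)
  then have cq: "customers N \<subseteq> (\<Union>j \<in> fleet kt 0. set (q j))" using cover by blast
  have ne: "customers N \<noteq> {}" using N by (simp add: valid_network_def)
  have "makespan \<alpha> N kt 0 q \<le> (1 + \<alpha> * real K) * T"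
    \<comment> \<open>Since \<open>kt\<close> is positive, \<open>Max\<close> ranges over a nonempty
      set.\<close>
    unfolding makespan_def using kt r(3)
    by (intro Max.boundedI) (auto simp: finite_fleet fleet_def q_def duration_eq_tour_length lessThan_empty_iff)
  then show "TSP \<alpha> N kt 0 (customers N) \<le> (1 + \<alpha> * real K) * T"
    using TSP_trucks_le[OF N ne _ q cq] by (meson order_refl order_trans)
  show "TSP \<alpha> N kt 0 (customers N) > 0" using TSP_trucks_pos[OF N ne _ q cq] by simp
qed

text \<open>The comparison holds for every time by which all vehicles have returned, hence for the
  infimum of these times. Positivity of the optimum permits the division.\<close>

lemma completion_ratio_lower:
  assumes \<alpha>: "\<alpha> > 0" and kt: "kt \<ge> 1" and K: "kd \<le> kt * K"
    and ALG: "online_policy kt kd \<alpha> ALG"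
    and N: "valid_network N" and D: "D \<subseteq> customers N"
  shows "1 / (1 + \<alpha> * real K) \<le> completion_time kt kd \<alpha> ALG N D / TSP \<alpha> N kt 0 (customers N)"
proof -
  \<comment> \<open>This is the choice made in \<open>completion_time\<close>, so both speak of the
    same execution.\<close>
  define X where "X = (SOME X. execution kt kd \<alpha> ALG N D X)"
  have "\<exists>X. execution kt kd \<alpha> ALG N D X" using ALG N D by (simp add: online_policy_def)
  then have X: "execution kt kd \<alpha> ALG N D X" unfolding X_def by (rule someI_ex)
  then have "(\<exists>T. returned_by kt kd N X T) \<and>
      (\<exists>p. (\<forall>j \<in> fleet kt kd. traces (X j) (p j)) \<and> feasible_solution kt kd N D p)"
    using ALG N D unfolding online_policy_def by blast
  then obtain T0 p where T0: "returned_by kt kd N X T0"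
    and p: "\<forall>j \<in> fleet kt kd. traces (X j) (p j)" "feasible_solution kt kd N D p"
    by blast
  let ?A = "1 + \<alpha> * real K" and ?W = "TSP \<alpha> N kt 0 (customers N)"
  have A: "?A > 0" using \<alpha> by (simp add: add_pos_nonneg)
  have *: "?W \<le> ?A * T \<and> ?W > 0" if T: "returned_by kt kd N X T" for T
  proof -
    have "T \<ge> 0" using T by (simp add: returned_by_def)
    moreover have "\<forall>j \<in> fleet kt kd. tour N (p j) \<and> duration \<alpha> N j (p j) \<le> T"
      using traced_tour_duration_le[OF N X \<alpha> _ _ _ T] p by (auto simp: feasible_solution_def)
    moreover have "customers N \<subseteq> (\<Union>j \<in> fleet kt kd. set (p j))"
      using p(2) by (auto simp: feasible_solution_def)
    ultimately show ?thesis using trucks_take_over_drone_tours[OF N \<alpha> kt K] by blast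
  qed
  have "?W / ?A \<le> Inf {T. returned_by kt kd N X T}"
    using T0 * A by (intro cInf_greatest) (auto simp: field_simps)
  then have "?W / ?A \<le> completion_time kt kd \<alpha> ALG N D"
    by (simp add: completion_time_def X_def)
  then show ?thesis using *[OF T0] A by (simp add: field_simps)
qed

theorem lemma8:
  fixes \<alpha> :: real and kt kd :: nat and ALG :: "'v policy"
  assumes "\<alpha> > 0" and "kt \<ge> 1" and "kd \<ge> 1"
    and "online_policy kt kd \<alpha> ALG"
  shows "best_case_ratio kt kd \<alpha> ALG \<ge> ereal (1 / (1 + \<alpha> * of_int \<lceil>real kd / real kt\<rceil>))"
proof -
  \<comment> \<open>The ceiling is nonnegative, so \<open>nat\<close> preserves its value; rounding
    up gives \<open>kd \<le> kt * K\<close>, enough places for all drone tours.\<close>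
  define K where "K = nat \<lceil>real kd / real kt\<rceil>"
  have K: "of_int \<lceil>real kd / real kt\<rceil> = real K" by (simp add: K_def)
  have "real kd / real kt \<le> real K" unfolding K_def by linarith
  then have "real kd \<le> real (kt * K)" using \<open>kt \<ge> 1\<close> by (simp add: field_simps)
  then have "kd \<le> kt * K" by linarith
  then show ?thesis
    unfolding best_case_ratio_def K
    using completion_ratio_lower[OF assms(1,2) _ assms(4)] by (intro INF_greatest) auto
qed

end
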